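(* Let $M=(0,1)\times\mathbf R$ (canal) or $M=(0,1)\times(0,L)$ (rectangular basin, $L>0$). Let $(\eta,v)$ be a classical solution on $[0,T]$ of the free boundary Euler system in the fluid domain over $M$ (written in the context), such that the Taylor coefficient $a(t,x)=-(\partial_yP)(t,x,\eta(t,x))$ is continuous and non-vanishing and $\eta(t,x)\ge b(x)+h$ for some positive constant $h$. Then the angle between the free surface $\Sigma(t)$ and the fixed boundary $\Gamma$ is a right angle: $$\forall t\in[0,T],\ \forall m\in\Sigma(t)\cap\Gamma,\qquad n\cdot\nu\,(t,m)=0,$$ which, on the walls $x_1=0$ and $x_1=1$, is equivalent to $\partial_{x_1}\eta(t,x_1,x_2)|_{x_1=0,1}=0$.
   Context: $b$ is a fixed continuous function on $M$, $x=(x_1,x_2)$. At time $t$ the fluid domain is $\Omega(t)=\{(x_1,x_2,y)\in M\times\mathbf R:b(x)<y<\eta(t,x)\}$, with free surface $\Sigma(t)=\{(x,y)\in M\times\mathbf R:y=\eta(t,x)\}$ and fixed boundary $\Gamma=\Gamma_1\cup\Gamma_2$, where $\Gamma_1=\{(x,y)\in M\times\mathbf R:y=b(x)\}$ and $\Gamma_2=\{(x,y)\in\partial M\times\mathbf R:b(x)<y<\eta(t,x)\}$. $n$ is the unit normal to $\Gamma$ and $\nu$ the unit normal to $\Sigma$; $\Sigma(t)\cap\Gamma$ denotes the set of points where (the closures of) the free surface and the fixed boundary meet, $n$ and $\nu$ there being defined by continuity (at points where the wall has a normal). $e_y$ is the vertical unit vector and $g>0$ the gravity. The system for $\eta$,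 the velocity $v:\Omega\to\mathbf R^3$ and the pressure $P$ is $$\partial_tv+v\cdot\nabla_{x,y}v+\nabla_{x,y}P=-ge_y,\quad \operatorname{div}_{x,y}v=0,\quad\operatorname{curl}_{x,y}v=0\quad\text{in }\Omega,$$ $$v\cdot n=0\ \text{on }\Gamma,\qquad \partial_t\eta=\sqrt{1+|\nabla\eta|^2}\,v\cdot\nu\ \text{on }\Sigma,\qquad P=0\ \text{on }\Sigma.$$ "Classical solution" means that $\eta,v,P$ are regular enough (up to the boundary, near the contact points) for all the equations to hold pointwise with continuous terms. *)

theory Defs
  imports "HOL-Analysis.Analysis"
begin

type_synonym R2 = "real \<times> real"   (* x = (x1, x2) *)
type_synonym R3 = "R2 \<times> real"     (* (x, y), so that M x R is a product set *)

definition e1 :: R3 where "e1 = ((1, 0), 0)"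
definition e2 :: R3 where "e2 = ((0, 1), 0)"
definition ey :: R3 where "ey = ((0, 0), 1)"

definition fluid_domain :: "R2 set \<Rightarrow> (R2 \<Rightarrow> real) \<Rightarrow> (R2 \<Rightarrow> real) \<Rightarrow> R3 set" where
  "fluid_domain M b \<zeta> = {(x, y). x \<in> M \<and> b x < y \<and> y < \<zeta> x}"

definition free_surface :: "R2 set \<Rightarrow> (R2 \<Rightarrow> real) \<Rightarrow> R3 set" where
  "free_surface M \<zeta> = {(x, y). x \<in> M \<and> y = \<zeta> x}"

definition bottom :: "R2 set \<Rightarrow> (R2 \<Rightarrow> real) \<Rightarrow> R3 set" where
  "bottom M b = {(x, y). x \<in> M \<and> y = b x}"

definition side_walls :: "R2 set \<Rightarrow> (R2 \<Rightarrow> real) \<Rightarrow> (R2 \<Rightarrow> real) \<Rightarrow> R3 set" where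
  "side_walls M b \<zeta> = {(x, y). x \<in> frontier M \<and> b x < y \<and> y < \<zeta> x}"

definition fixed_boundary :: "R2 set \<Rightarrow> (R2 \<Rightarrow> real) \<Rightarrow> (R2 \<Rightarrow> real) \<Rightarrow> R3 set" where
  "fixed_boundary M b \<zeta> = bottom M b \<union> side_walls M b \<zeta>"

(* N is orthogonal to the surface S at p: S is tangent at p to the plane p + N^perp. *)
definition orthogonal_to_surface :: "R3 set \<Rightarrow> R3 \<Rightarrow> R3 \<Rightarrow> bool" where
  "orthogonal_to_surface S p N \<longleftrightarrow>
     ((\<lambda>q. (N \<bullet> (q - p)) / norm (q - p)) \<longlongrightarrow> 0) (at p within S)"

(* N is the unit normal to S at p, up to sign.  The second clause says that S has a well-defined
   normal line at p.  At an edge point of a surface with boundary this is the one-sided tangent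
   plane, i.e. the normal extended by continuity; where two walls meet there is no normal. *)
definition unit_normal :: "R3 set \<Rightarrow> R3 \<Rightarrow> R3 \<Rightarrow> bool" where
  "unit_normal S p N \<longleftrightarrow> norm N = 1 \<and> orthogonal_to_surface S p N \<and>
     (\<forall>N'. norm N' = 1 \<and> orthogonal_to_surface S p N' \<longrightarrow> N' = N \<or> N' = - N)"

definition grad :: "('a::euclidean_space \<Rightarrow> real) \<Rightarrow> 'a \<Rightarrow> 'a" where
  "grad f p = (\<Sum>i\<in>Basis. frechet_derivative f (at p) i *\<^sub>R i)"

definition divergence :: "(R3 \<Rightarrow> R3) \<Rightarrow> R3 \<Rightarrow> real" where
  "divergence u p = (\<Sum>i\<in>Basis. frechet_derivative u (at p) i \<bullet> i)"

definition curl :: "(R3 \<Rightarrow> R3) \<Rightarrow> R3 \<Rightarrow> R3" where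
  "curl u p =
     (let D = frechet_derivative u (at p) in
       ((D e2 \<bullet> ey - D ey \<bullet> e2, D ey \<bullet> e1 - D e1 \<bullet> ey), D e1 \<bullet> e2 - D e2 \<bullet> e1))"

definition convective :: "(R3 \<Rightarrow> R3) \<Rightarrow> R3 \<Rightarrow> R3" where   (* (u . grad) u *)
  "convective u p = frechet_derivative u (at p) (u p)"

definition time_deriv :: "real \<Rightarrow> (real \<Rightarrow> 'a::real_normed_vector) \<Rightarrow> real \<Rightarrow> 'a" where
  "time_deriv T f t = vector_derivative f (at t within {0..T})"

definition fluid_spacetime ::
    "R2 set \<Rightarrow> real \<Rightarrow> (R2 \<Rightarrow> real) \<Rightarrow> (real \<Rightarrow> R2 \<Rightarrow> real) \<Rightarrow> (real \<times> R3) set" where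
  "fluid_spacetime M T b \<eta> = {(t, p). t \<in> {0..T} \<and> p \<in> fluid_domain M b (\<eta> t)}"

definition closed_fluid_spacetime ::
    "R2 set \<Rightarrow> real \<Rightarrow> (R2 \<Rightarrow> real) \<Rightarrow> (real \<Rightarrow> R2 \<Rightarrow> real) \<Rightarrow> (real \<times> R3) set" where
  "closed_fluid_spacetime M T b \<eta> =
     {(t, p). t \<in> {0..T} \<and> p \<in> closure (fluid_domain M b (\<eta> t))}"

definition contact_spacetime ::
    "R2 set \<Rightarrow> real \<Rightarrow> (R2 \<Rightarrow> real) \<Rightarrow> (real \<Rightarrow> R2 \<Rightarrow> real) \<Rightarrow> (real \<times> R3) set" where
  "contact_spacetime M T b \<eta> =
     {(t, m). t \<in> {0..T} \<and>
        m \<in> closure (free_surface M (\<eta> t)) \<inter> closure (fixed_boundary M b (\<eta> t))}"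

(* f is C^1 at the points of W, derivatives at boundary points of S being taken from within S. *)
definition C1_within ::
    "'a::real_normed_vector set \<Rightarrow> 'a set \<Rightarrow> ('a \<Rightarrow> 'b::real_normed_vector) \<Rightarrow> bool" where
  "C1_within W S f \<longleftrightarrow>
     (\<exists>f' :: 'a \<Rightarrow> 'a \<Rightarrow>\<^sub>L 'b.
        (\<forall>z\<in>W. (f has_derivative blinfun_apply (f' z)) (at z within S)) \<and> continuous_on W f')"

(* The velocity and the pressure are continuous up to the boundary; v and the spatial gradient of P
   are C^1, respectively continuous, in the open fluid domain and up to the boundary near the
   contact points, i.e. on a relatively open set W containing both.  No more is asked near the
   bottom, where b is merely continuous.  No time derivative of P occurs in the system, so none is
   required. *)
definition regular_flow ::
    "R2 set \<Rightarrow> real \<Rightarrow> (R2 \<Rightarrow> real) \<Rightarrow> (real \<Rightarrow> R2 \<Rightarrow> real) \<Rightarrow>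
     (real \<Rightarrow> R3 \<Rightarrow> R3) \<Rightarrow> (real \<Rightarrow> R3 \<Rightarrow> real) \<Rightarrow> bool" where
  "regular_flow M T b \<eta> v P \<longleftrightarrow>
     C1_within ({0..T} \<times> closure M) ({0..T} \<times> closure M) (\<lambda>(t, x). \<eta> t x) \<and>
     continuous_on (closed_fluid_spacetime M T b \<eta>) (\<lambda>(t, p). v t p) \<and>
     continuous_on (closed_fluid_spacetime M T b \<eta>) (\<lambda>(t, p). P t p) \<and>
     (\<exists>W. openin (top_of_set (closed_fluid_spacetime M T b \<eta>)) W \<and>
        fluid_spacetime M T b \<eta> \<subseteq> W \<and> contact_spacetime M T b \<eta> \<subseteq> W \<and>
        C1_within W (closed_fluid_spacetime M T b \<eta>) (\<lambda>(t, p). v t p) \<and>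
        (\<exists>P' :: real \<times> R3 \<Rightarrow> R3 \<Rightarrow>\<^sub>L real. continuous_on W P' \<and>
           (\<forall>(t, p)\<in>W. (P t has_derivative blinfun_apply (P' (t, p)))
                          (at p within closure (fluid_domain M b (\<eta> t))))))"

(* The boundary condition v . n = 0 is imposed wherever the fixed boundary has a normal.  In the
   kinematic condition the normal to the free surface points upwards. *)
definition classical_solution ::
    "R2 set \<Rightarrow> real \<Rightarrow> real \<Rightarrow> (R2 \<Rightarrow> real) \<Rightarrow> (real \<Rightarrow> R2 \<Rightarrow> real) \<Rightarrow>
     (real \<Rightarrow> R3 \<Rightarrow> R3) \<Rightarrow> (real \<Rightarrow> R3 \<Rightarrow> real) \<Rightarrow> bool" where
  "classical_solution M T g b \<eta> v P \<longleftrightarrow>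
     regular_flow M T b \<eta> v P \<and>
     (\<forall>t\<in>{0..T}. \<forall>p\<in>fluid_domain M b (\<eta> t).
        time_deriv T (\<lambda>s. v s p) t + convective (v t) p + grad (P t) p = - g *\<^sub>R ey \<and>
        divergence (v t) p = 0 \<and>
        curl (v t) p = 0) \<and>
     (\<forall>t\<in>{0..T}. \<forall>m\<in>fixed_boundary M b (\<eta> t). \<forall>n.
        unit_normal (fixed_boundary M b (\<eta> t)) m n \<longrightarrow> v t m \<bullet> n = 0) \<and>
     (\<forall>t\<in>{0..T}. \<forall>x\<in>M. \<forall>\<nu>.
        unit_normal (free_surface M (\<eta> t)) (x, \<eta> t x) \<nu> \<and> \<nu> \<bullet> ey > 0 \<longrightarrow>
        time_deriv T (\<lambda>s. \<eta> s x) t =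
          sqrt (1 + (norm (grad (\<eta> t) x))\<^sup>2) * (v t (x, \<eta> t x) \<bullet> \<nu>)) \<and>
     (\<forall>t\<in>{0..T}. \<forall>m\<in>free_surface M (\<eta> t). P t m = 0)"

end

theory Submission
  imports Defs
begin

text \<open>On a wall with normal \<open>d\<close> the velocity is tangent to the wall, so particles on the wall stay on
  it and the material derivative of \<open>v \<bullet> d\<close> vanishes there; the momentum equation, extended to the
  wall near a contact point by continuity, leaves \<open>\<partial>\<^sub>dP = 0\<close>. Differentiating \<open>P = 0\<close> along the
  free surface in the direction \<open>d\<close> gives \<open>\<partial>\<^sub>dP - a \<partial>\<^sub>d\<eta> = 0\<close>, and \<open>a \<noteq> 0\<close> forces \<open>\<partial>\<^sub>d\<eta> = 0\<close>.
  At a corner of the basin the two walls meeting there have no common normal, so the claim is void.\<close>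

subsection \<open>Derivatives along curves\<close>

text \<open>No equation of the system is imposed at a contact point itself: the momentum equation
  lives in the open fluid domain, tangency on the wall strictly below the surface, and
  \<open>P = 0\<close> over the open set \<open>M\<close>. Each has to be carried to the contact
  point along its own approach. Tangency is differentiated before passing to the limit, not after:
  at the contact point a curve with the velocity of the fluid could leave the closed fluid domain
  through the surface, while strictly below it small motions are harmless. The relatively open set
  \<open>W\<close> of \<open>regular_flow\<close> then carries the differentiated identity upwards,
  since the derivatives of \<open>v\<close> and \<open>P\<close> are continuous on it. Contact
  points are edge points and \<open>t\<close> may be \<open>0\<close> or \<open>T\<close>, so
  derivatives are taken along curves that stay only eventually, and often only on one side, in the
  set at hand.\<close>

lemma has_vector_derivative_compose_eventually:
  assumes f: "(f has_derivative f') (at (\<gamma> s) within S)"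
    and \<gamma>: "(\<gamma> has_vector_derivative u) (at s within A)"
    and S: "\<forall>\<^sub>F r in at s within A. \<gamma> r \<in> S"
  shows "((\<lambda>r. f (\<gamma> r)) has_vector_derivative f' u) (at s within A)"
proof -
  obtain U where U: "open U" "s \<in> U" "\<And>r. r \<in> U \<Longrightarrow> r \<in> A \<Longrightarrow> r \<noteq> s \<Longrightarrow> \<gamma> r \<in> S"
    using S unfolding eventually_at_topological by metis
  have eq: "at s within A = at s within (A \<inter> U)"
    using U by (intro at_within_nhd[of s U]) auto
  \<comment> \<open>A derivative within \<open>S\<close> ignores whether the base point belongs to
    \<open>S\<close>. Adding it means that \<open>\<gamma> s\<close> itself need not lie in
    \<open>S\<close>.\<close>
  have f: "(f has_derivative f') (at (\<gamma> s) within insert (\<gamma> s) S)"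
    using f by (simp add: at_within_def insert_Diff_if)
  have "((\<lambda>r. f (\<gamma> r)) has_derivative (\<lambda>h. f' (h *\<^sub>R u))) (at s within (A \<inter> U))"
    using U(3) \<gamma> unfolding has_vector_derivative_def eq
    by (intro has_derivative_in_compose[where g=f and f=\<gamma>] has_derivative_subset[OF f]) auto
  moreover have "f' (h *\<^sub>R u) = h *\<^sub>R f' u" for h
    using has_derivative_bounded_linear[OF f] by (simp add: linear_simps)
  ultimately show ?thesis by (simp add: has_vector_derivative_def eq)
qed

text \<open>This carries identities to the contact points. The closure is taken in the whole space,
  but only limit points inside \<open>W\<close> are reached, because \<open>f\<close> is controlled
  nowhere else: the level set is the trace on \<open>W\<close> of a closed set, and that closed set
  contains the closure of \<open>A\<close>.\<close>

lemma continuous_on_closure_const: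
  fixes f :: "'a::topological_space \<Rightarrow> 'b::t1_space"
  assumes "continuous_on W f" "A \<subseteq> W" "\<And>x. x \<in> A \<Longrightarrow> f x = c" "z \<in> W" "z \<in> closure A"
  shows "f z = c"
proof -
  have "closedin (top_of_set W) (W \<inter> f -` {c})"
    using assms(1) by (rule continuous_closedin_preimage) simp
  then obtain C where "closed C" "W \<inter> f -` {c} = W \<inter> C"
    by (auto simp: closedin_closed)
  then show ?thesis
    using closure_minimal[of A C] assms by blast
qed

lemma orthogonal_to_surfaceI:
  assumes "\<forall>\<^sub>F q in at p within S. N \<bullet> (q - p) = 0"
  shows "orthogonal_to_surface S p N"
  unfolding orthogonal_to_surface_def
  by (rule tendsto_eventually) (use assms in eventually_elim, simp)

text \<open>A normal annihilates the velocity of every curve running in the surface: up to sign,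
  \<open>N\<close> paired with the difference quotient is the quotient defining orthogonality, which
  tends to 0, times the norm of the difference quotient, which tends to
  \<open>norm u\<close>.\<close>

lemma orthogonal_to_surfaceD:
  assumes N: "orthogonal_to_surface S (\<gamma> s) N"
    and \<gamma>: "(\<gamma> has_vector_derivative u) (at s within A)"
    and S: "\<forall>\<^sub>F r in at s within A. \<gamma> r \<in> S" and nontriv: "at s within A \<noteq> bot"
  shows "N \<bullet> u = 0"
proof -
  \<comment> \<open>At the base point this reads 0 / 0 = 0, so \<open>f\<close> is continuous there
    within \<open>S\<close>, and the curve may return to its starting point.\<close>
  define f where "f q = N \<bullet> (q - \<gamma> s) / norm (q - \<gamma> s)" for q
  have q: "((\<lambda>r. (\<gamma> r - \<gamma> s) /\<^sub>R (r - s)) \<longlongrightarrow> u) (at s within A)"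
  proof (rule LIM_zero_cancel, rule tendsto_norm_zero_cancel, rule Lim_transform_eventually)
    show "((\<lambda>r. norm ((\<gamma> r - \<gamma> s) - (r - s) *\<^sub>R u) / norm (r - s)) \<longlongrightarrow> 0) (at s within A)"
      using \<gamma> by (simp add: has_vector_derivative_def has_derivative_iff_norm)
    have "norm ((\<gamma> r - \<gamma> s) - (r - s) *\<^sub>R u) / norm (r - s) = norm ((\<gamma> r - \<gamma> s) /\<^sub>R (r - s) - u)"
      if "r \<noteq> s" for r
    proof -
      have "(\<gamma> r - \<gamma> s) /\<^sub>R (r - s) - u = ((\<gamma> r - \<gamma> s) - (r - s) *\<^sub>R u) /\<^sub>R (r - s)"
        using that by (simp add: scaleR_diff_right)
      then show ?thesis by (simp add: divide_inverse_commute)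
    qed
    then show "\<forall>\<^sub>F r in at s within A. norm ((\<gamma> r - \<gamma> s) - (r - s) *\<^sub>R u) / norm (r - s)
        = norm ((\<gamma> r - \<gamma> s) /\<^sub>R (r - s) - u)"
      by (simp add: eventually_at_filter)
  qed
  have \<gamma>_lim: "(\<gamma> \<longlongrightarrow> \<gamma> s) (at s within A)"
    using has_vector_derivative_continuous[OF \<gamma>] by (simp add: continuous_within)
  have "(f \<longlongrightarrow> f (\<gamma> s)) (at (\<gamma> s) within S)"
    using N by (simp add: orthogonal_to_surface_def f_def[abs_def])
  then have "((\<lambda>r. f (\<gamma> r)) \<longlongrightarrow> f (\<gamma> s)) (at s within A)"
    by (intro continuous_within_tendsto_compose[OF _ S \<gamma>_lim]) (simp add: continuous_within)
  then have f0: "((\<lambda>r. f (\<gamma> r)) \<longlongrightarrow> 0) (at s within A)" by (simp add: f_def)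
  have "((\<lambda>r. f (\<gamma> r) * norm ((\<gamma> r - \<gamma> s) /\<^sub>R (r - s))) \<longlongrightarrow> 0 * norm u) (at s within A)"
    by (intro tendsto_mult tendsto_norm f0 q)
  then have "((\<lambda>r. \<bar>f (\<gamma> r) * norm ((\<gamma> r - \<gamma> s) /\<^sub>R (r - s))\<bar>) \<longlongrightarrow> 0) (at s within A)"
    by (intro tendsto_rabs_zero) simp
  \<comment> \<open>Absolute values absorb the sign of \<open>r - s\<close>, since \<open>A\<close>
    may extend to both sides of \<open>s\<close>.\<close>
  moreover have "\<bar>f (\<gamma> r) * norm ((\<gamma> r - \<gamma> s) /\<^sub>R (r - s))\<bar> = \<bar>N \<bullet> ((\<gamma> r - \<gamma> s) /\<^sub>R (r - s))\<bar>" for r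
    by (cases "\<gamma> r = \<gamma> s") (simp_all add: f_def abs_mult)
  ultimately have "((\<lambda>r. \<bar>N \<bullet> ((\<gamma> r - \<gamma> s) /\<^sub>R (r - s))\<bar>) \<longlongrightarrow> 0) (at s within A)" by simp
  moreover have "((\<lambda>r. \<bar>N \<bullet> ((\<gamma> r - \<gamma> s) /\<^sub>R (r - s))\<bar>) \<longlongrightarrow> \<bar>N \<bullet> u\<bar>) (at s within A)"
    by (intro tendsto_rabs tendsto_inner tendsto_const q)
  ultimately show ?thesis
    using tendsto_unique[OF nontriv] by fastforce
qed

subsection \<open>Flat walls\<close>

definition rot :: "R2 \<Rightarrow> R2" where "rot d = (- snd d, fst d)"

lemma inner_rot [simp]: "rot d \<bullet> d = 0"
  by (simp add: rot_def inner_prod_def)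

text \<open>For a unit vector \<open>d\<close>, the vectors \<open>(d, 0)\<close>,
  \<open>(rot d, 0)\<close> and \<open>ey\<close> form an orthonormal frame, and two of the three
  coordinates of \<open>N\<close> vanish.\<close>

lemma horizontal_decomposition:
  fixes N :: R3
  assumes d: "norm d = 1" and "N \<bullet> (rot d, 0) = 0" "N \<bullet> ey = 0"
  shows "N = (N \<bullet> (d, 0)) *\<^sub>R (d, 0)"
proof -
  obtain n1 n2 n3 where N: "N = ((n1, n2), n3)" by (metis surj_pair)
  obtain d1 d2 where D: "d = (d1, d2)" by fastforce
  have 1: "d1 * d1 + d2 * d2 = 1"
    using d by (simp add: D norm_prod_def power2_eq_square)
  have 2: "n2 * d1 = n1 * d2" "n3 = 0"
    using assms(2,3) by (auto simp: N D rot_def ey_def)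
  have "n1 = (n1 * d1 + n2 * d2) * d1" "n2 = (n1 * d1 + n2 * d2) * d2"
    using 1 2 by algebra+
  then show ?thesis by (simp add: N D 2)
qed

text \<open>Near \<open>x\<close>, the set \<open>M\<close> is a half-plane with inward unit normal \<open>d\<close>.\<close>

definition flat_wall :: "R2 set \<Rightarrow> R2 \<Rightarrow> R2 \<Rightarrow> bool" where
  "flat_wall M x d \<longleftrightarrow> norm d = 1 \<and> (\<forall>\<^sub>F x' in nhds x. x' \<in> M \<longleftrightarrow> 0 < (x' - x) \<bullet> d)"

text \<open>Moving the base point along the line orthogonal to \<open>d\<close> leaves the
  half-plane unchanged, and what holds near \<open>x\<close> holds near every point close to
  \<open>x\<close>. A curve sliding along the wall therefore keeps meeting wall points with the same
  normal.\<close>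

lemma flat_wall_nearby:
  assumes "flat_wall M x d"
  shows "\<forall>\<^sub>F x' in nhds x. (x' - x) \<bullet> d = 0 \<longrightarrow> flat_wall M x' d"
proof -
  have "\<forall>\<^sub>F x' in nhds x. \<forall>\<^sub>F x'' in nhds x'. x'' \<in> M \<longleftrightarrow> 0 < (x'' - x) \<bullet> d"
    using assms by (simp add: flat_wall_def eventually_eventually)
  then show ?thesis
    by (rule eventually_mono)
      (use assms in \<open>auto simp: flat_wall_def inner_diff_left algebra_simps\<close>)
qed

lemma flat_wall_inward:
  assumes "flat_wall M x d"
  shows "\<forall>\<^sub>F s in at_right 0. x + s *\<^sub>R d \<in> M"
proof -
  have "((\<lambda>s. x + s *\<^sub>R d) \<longlongrightarrow> x + 0 *\<^sub>R d) (at_right 0)"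
    by (intro tendsto_intros)
  then have "\<forall>\<^sub>F s in at_right 0. x + s *\<^sub>R d \<in> M \<longleftrightarrow> 0 < (x + s *\<^sub>R d - x) \<bullet> d"
    by (rule eventually_compose_filterlim[rotated]) (use assms in \<open>simp add: flat_wall_def\<close>)
  then show ?thesis
    using eventually_at_right_less[of 0]
    by eventually_elim (use assms in \<open>simp add: flat_wall_def norm_eq_1\<close>)
qed

lemma flat_wall_frontier_point:
  assumes "flat_wall M x d"
  shows "x \<in> frontier M"
proof -
  have "x \<notin> M"
    using assms eventually_nhds_x_imp_x by (fastforce simp: flat_wall_def)
  moreover have "((\<lambda>s. x + s *\<^sub>R d) \<longlongrightarrow> x + 0 *\<^sub>R d) (at_right 0)"
    by (intro tendsto_intros)
  then have "x \<in> closure M"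
    by (intro Lim_in_closed_set[OF closed_closure _ trivial_limit_at_right_real, of _ _ 0])
      (use eventually_mono[OF flat_wall_inward[OF assms] subsetD[OF closure_subset]] in auto)
  ultimately show ?thesis
    using interior_subset by (auto simp: frontier_def)
qed

lemma flat_wall_frontier:
  assumes "flat_wall M x d" "open M"
  shows "\<forall>\<^sub>F x' in nhds x. x' \<in> frontier M \<longleftrightarrow> (x' - x) \<bullet> d = 0"
proof -
  have "\<forall>\<^sub>F x' in nhds x. \<forall>\<^sub>F x'' in nhds x'. x'' \<in> M \<longleftrightarrow> 0 < (x'' - x) \<bullet> d"
    using assms(1) by (simp add: flat_wall_def eventually_eventually)
  with flat_wall_nearby[OF assms(1)] show ?thesis
  proof eventually_elim
    case (elim x')
    show ?case
    proof
      assume "(x' - x) \<bullet> d = 0"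
      then show "x' \<in> frontier M"
        using elim flat_wall_frontier_point by blast
    next
      assume fr: "x' \<in> frontier M"
      then have "x' \<notin> M" using assms(2) by (simp add: frontier_def interior_open)
      then have "(x' - x) \<bullet> d \<le> 0" 
        using elim(2) eventually_nhds_x_imp_x by fastforce
      moreover have False if neg: "(x' - x) \<bullet> d < 0"
      proof -
        have "\<forall>\<^sub>F x'' in nhds x'. (x'' - x) \<bullet> d < 0"
          using neg by (intro order_tendstoD(2)[of _ "(x' - x) \<bullet> d"] tendsto_intros) (auto simp: filterlim_ident)
        with elim(2) have "\<forall>\<^sub>F x'' in nhds x'. x'' \<notin> M"
          by eventually_elim auto
        then obtain U where "open U" "x' \<in> U" "U \<inter> M = {}"
          by (auto simp: eventually_nhds)
        then have "x' \<notin> closure M"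
          using open_Int_closure_eq_empty by blast
        then show False using fr by (simp add: frontier_def)
      qed
      ultimately show "(x' - x) \<bullet> d = 0" by force
    qed
  qed
qed

section \<open>Further calculus along curves, and closures of graphs and vertical segments\<close>

lemma has_vector_derivative_Pair:
  assumes "(f has_vector_derivative f') (at x within S)" "(g has_vector_derivative g') (at x within S)"
  shows "((\<lambda>x. (f x, g x)) has_vector_derivative (f', g')) (at x within S)"
  using has_derivative_Pair[OF assms[unfolded has_vector_derivative_def]]
  by (simp add: has_vector_derivative_def)

lemma has_vector_derivative_line:
  "((\<lambda>s. p + (s - t) *\<^sub>R u) has_vector_derivative u) (at t within A)"
  by (auto intro!: derivative_eq_intros)

lemma tendsto_line: "((\<lambda>s. p + (s - t) *\<^sub>R u) \<longlongrightarrow> (p::'a::real_normed_vector)) (at t within A)"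
  by (auto intro!: tendsto_eq_intros)

text \<open>Continuity supplies the value at \<open>x\<close>, which is not assumed to be
  \<open>c\<close>. This fits the pressure along the free surface: it is prescribed over
  \<open>M\<close> but not at the wall, where the curve starts.\<close>

lemma has_vector_derivative_eventually_const:
  assumes f: "(f has_vector_derivative u) (at x within A)"
    and c: "\<forall>\<^sub>F s in at x within A. f s = c" and nontriv: "at x within A \<noteq> bot"
  shows "u = 0"
proof -
  have "(f \<longlongrightarrow> f x) (at x within A)"
    using has_vector_derivative_continuous[OF f] by (simp add: continuous_within)
  moreover have "(f \<longlongrightarrow> c) (at x within A)"
    using c by (rule tendsto_eventually)
  ultimately have fx: "f x = c" by (rule tendsto_unique[OF nontriv])
  have "\<forall>\<^sub>F s in nhds x. s \<in> A \<longrightarrow> f s = c"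
    using c unfolding eventually_at_filter by eventually_elim (use fx in auto)
  then have "((\<lambda>_. c) has_vector_derivative u) (at x within A)"
    using f fx has_vector_derivative_cong_ev[of A f "\<lambda>_. c" x u] by simp
  then show ?thesis
    using vector_derivative_unique_within[OF nontriv] has_vector_derivative_const by blast
qed

lemma grad_inner:
  fixes f :: "'a::euclidean_space \<Rightarrow> real"
  assumes "(f has_derivative f') (at p)"
  shows "grad f p \<bullet> u = f' u"
proof -
  interpret linear f' using assms by (rule has_derivative_linear)
  have "f' u = f' (\<Sum>i\<in>Basis. (u \<bullet> i) *\<^sub>R i)" by (simp add: euclidean_representation)
  also have "\<dots> = (\<Sum>i\<in>Basis. (u \<bullet> i) * f' i)" by (simp add: sum scale)
  finally show ?thesis
    by (simp add: grad_def frechet_derivative_at[OF assms, symmetric] inner_sum_left inner_commute[of u] mult.commute)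
qed

lemma closure_graph:
  fixes \<zeta> :: "R2 \<Rightarrow> real"
  assumes "continuous_on (closure M) \<zeta>"
  shows "closure {(x, y). x \<in> M \<and> y = \<zeta> x} = {(x, y). x \<in> closure M \<and> y = \<zeta> x}"
proof
  have "closedin (top_of_set (closure M \<times> UNIV)) {z \<in> closure M \<times> UNIV. snd z - \<zeta> (fst z) = 0}"
    using assms by (intro continuous_closedin_preimage_constant continuous_intros
        continuous_on_compose2[OF assms]) auto
  then have "closed {z \<in> closure M \<times> UNIV. snd z - \<zeta> (fst z) = 0}"
    by (rule closedin_closed_trans) (simp add: closed_Times)
  moreover have "{z \<in> closure M \<times> UNIV. snd z - \<zeta> (fst z) = 0} = {(x, y). x \<in> closure M \<and> y = \<zeta> x}"
    by auto
  ultimately show "closure {(x, y). x \<in> M \<and> y = \<zeta> x} \<subseteq> {(x, y). x \<in> closure M \<and> y = \<zeta> x}"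
    using closure_subset[of M] by (intro closure_minimal) auto
next
  have "(\<lambda>x. (x, \<zeta> x)) ` closure M \<subseteq> closure {(x, y). x \<in> M \<and> y = \<zeta> x}"
    using assms closure_subset[of "{(x, y). x \<in> M \<and> y = \<zeta> x}"]
    by (intro image_closure_subset continuous_intros) auto
  then show "{(x, y). x \<in> closure M \<and> y = \<zeta> x} \<subseteq> closure {(x, y). x \<in> M \<and> y = \<zeta> x}"
    by auto
qed

text \<open>Membership in a closure need only be checked strictly between the ends, where the
  inequalities survive small perturbations.\<close>

lemma closure_vertical_segment:
  fixes x :: R2 and \<alpha> \<beta> :: real
  assumes "\<alpha> < \<beta>" "\<alpha> \<le> y" "y \<le> \<beta>" "\<And>y. \<alpha> < y \<Longrightarrow> y < \<beta> \<Longrightarrow> (x, y) \<in> closure S"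
  shows "(x, y) \<in> closure S"
proof -
  have "closure ({x} \<times> {\<alpha><..<\<beta>}) \<subseteq> closure S"
    using assms(4) by (intro closure_minimal) auto
  then show ?thesis
    using assms(1-3) by (auto simp: closure_Times)
qed

lemma at_within_Icc_neq_bot:
  fixes t :: real
  assumes "t \<in> {a..b}" "a < b"
  shows "at t within {a..b} \<noteq> bot"
  using assms islimpt_Icc[of a b t] by (simp add: trivial_limit_within)

subsection \<open>The flow near a contact point\<close>

text \<open>The existential witnesses of \<open>regular_flow\<close> get names:
  \<open>\<eta>'\<close>, \<open>W\<close>, \<open>v'\<close>, \<open>P'\<close>. Of
  \<open>M\<close> only openness is assumed; its shape enters through \<open>flat_wall\<close>, so
  that all walls of the canal and of the basin are treated at once.\<close>

locale contact_flow =
  fixes M :: "R2 set" and T g h :: real and b :: "R2 \<Rightarrow> real" and \<eta> :: "real \<Rightarrow> R2 \<Rightarrow> real"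
    and v :: "real \<Rightarrow> R3 \<Rightarrow> R3" and P :: "real \<Rightarrow> R3 \<Rightarrow> real" and a :: "real \<Rightarrow> R2 \<Rightarrow> real"
    and \<eta>' :: "real \<times> R2 \<Rightarrow> (real \<times> R2) \<Rightarrow>\<^sub>L real" and W :: "(real \<times> R3) set"
    and v' :: "real \<times> R3 \<Rightarrow> (real \<times> R3) \<Rightarrow>\<^sub>L R3" and P' :: "real \<times> R3 \<Rightarrow> R3 \<Rightarrow>\<^sub>L real"
  assumes T_pos: "0 < T" and M_open: "open M"
    and b_continuous: "continuous_on (closure M) b"
    and h_pos: "0 < h"
    and uniform_depth: "\<And>t x. t \<in> {0..T} \<Longrightarrow> x \<in> M \<Longrightarrow> b x + h \<le> \<eta> t x"
    and \<eta>_deriv: "\<And>z. z \<in> {0..T} \<times> closure M \<Longrightarrow>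
      ((\<lambda>(t, x). \<eta> t x) has_derivative blinfun_apply (\<eta>' z)) (at z within {0..T} \<times> closure M)"
    and W_open: "openin (top_of_set (closed_fluid_spacetime M T b \<eta>)) W"
    and fluid_in_W: "fluid_spacetime M T b \<eta> \<subseteq> W"
    and contact_in_W: "contact_spacetime M T b \<eta> \<subseteq> W"
    and v_deriv: "\<And>z. z \<in> W \<Longrightarrow>
      ((\<lambda>(t, p). v t p) has_derivative blinfun_apply (v' z)) (at z within closed_fluid_spacetime M T b \<eta>)"
    and v'_continuous: "continuous_on W v'"
    and P_deriv: "\<And>t p. (t, p) \<in> W \<Longrightarrow>
      (P t has_derivative blinfun_apply (P' (t, p))) (at p within closure (fluid_domain M b (\<eta> t)))"
    and P'_continuous: "continuous_on W P'"
    and momentum: "\<And>t p. t \<in> {0..T} \<Longrightarrow> p \<in> fluid_domain M b (\<eta> t) \<Longrightarrow>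
      time_deriv T (\<lambda>s. v s p) t + convective (v t) p + grad (P t) p = - g *\<^sub>R ey"
    and no_penetration: "\<And>t m n. t \<in> {0..T} \<Longrightarrow> m \<in> fixed_boundary M b (\<eta> t) \<Longrightarrow>
      unit_normal (fixed_boundary M b (\<eta> t)) m n \<Longrightarrow> v t m \<bullet> n = 0"
    and P_surface: "\<And>t m. t \<in> {0..T} \<Longrightarrow> m \<in> free_surface M (\<eta> t) \<Longrightarrow> P t m = 0"
    and taylor: "\<And>t x. t \<in> {0..T} \<Longrightarrow> x \<in> closure M \<Longrightarrow>
      ((\<lambda>y. P t (x, y)) has_real_derivative (- a t x)) (at (\<eta> t x) within {b x..\<eta> t x})"
    and taylor_nonzero: "\<And>t x. t \<in> {0..T} \<Longrightarrow> x \<in> closure M \<Longrightarrow> a t x \<noteq> 0"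
begin

abbreviation "\<Omega> t \<equiv> fluid_domain M b (\<eta> t)"
abbreviation "Q \<equiv> closed_fluid_spacetime M T b \<eta>"

section \<open>Shape of the fluid domain, its closure and the contact points\<close>

lemma \<eta>_continuous: "continuous_on ({0..T} \<times> closure M) (\<lambda>(t, x). \<eta> t x)"
  using \<eta>_deriv by (rule has_derivative_continuous_on)

lemma \<eta>_slice_continuous:
  assumes "t \<in> {0..T}"
  shows "continuous_on (closure M) (\<eta> t)"
proof -
  have "continuous_on (closure M) (\<lambda>x. (t, x))"
    by (intro continuous_on_Pair continuous_on_const continuous_on_id)
  from continuous_on_compose2[OF \<eta>_continuous this] show ?thesis using assms by (force simp: image_subset_iff)
qed

text \<open>A bare strict inequality over \<open>M\<close> could degenerate at the wall; the margin
  \<open>h\<close> survives the passage to the closure and keeps the contact points away from the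
  bottom.\<close>

lemma depth:
  assumes "t \<in> {0..T}" "x \<in> closure M"
  shows "b x < \<eta> t x"
proof -
  have "continuous_on (closure M) (\<lambda>x. \<eta> t x - b x)"
    by (intro continuous_on_diff \<eta>_slice_continuous b_continuous assms(1))
  then have "h \<le> \<eta> t x - b x"
    using assms(2) by (rule continuous_ge_on_closure)
      (use uniform_depth[OF assms(1)] in \<open>simp add: algebra_simps\<close>)
  with h_pos show ?thesis by linarith
qed

lemma frontier_in_closure: "x \<in> frontier M \<Longrightarrow> x \<in> closure M"
  by (simp add: frontier_def)

lemma in_closure: "x \<in> M \<Longrightarrow> x \<in> closure M"
  using closure_subset by blast

text \<open>Lying strictly between bottom and surface is stable under small motions in spacetime,
  also at wall points and at the end times; the premises on \<open>s\<close> and \<open>x'\<close>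
  are there because \<open>b\<close> and \<open>\<eta>\<close> are controlled only on the closed
  sets.\<close>

lemma nearby_column:
  assumes "t \<in> {0..T}" "x \<in> closure M" "b x < y" "y < \<eta> t x"
  shows "\<forall>\<^sub>F (s, x', y') in nhds (t, x, y).
    s \<in> {0..T} \<longrightarrow> x' \<in> closure M \<longrightarrow> b x' < y' \<and> y' < \<eta> s x'"
proof -
  let ?K = "{0..T} \<times> closure M \<times> (UNIV :: real set)"
  have "continuous_on ?K (\<lambda>z. snd (snd z) - b (fst (snd z)))"
       "continuous_on ?K (\<lambda>z. (\<lambda>(t, x). \<eta> t x) (fst z, fst (snd z)) - snd (snd z))"
    by (intro continuous_intros continuous_on_compose2[OF b_continuous]
        continuous_on_compose2[OF \<eta>_continuous]; force)+
  then have lim: "((\<lambda>z. snd (snd z) - b (fst (snd z))) \<longlongrightarrow> y - b x) (at (t, x, y) within ?K)"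
       "((\<lambda>z. (\<lambda>(t, x). \<eta> t x) (fst z, fst (snd z)) - snd (snd z)) \<longlongrightarrow> \<eta> t x - y) (at (t, x, y) within ?K)"
    using assms by (auto simp: continuous_on_def)
  have "\<forall>\<^sub>F z in at (t, x, y) within ?K. 0 < snd (snd z) - b (fst (snd z))"
    "\<forall>\<^sub>F z in at (t, x, y) within ?K. 0 < (\<lambda>(t, x). \<eta> t x) (fst z, fst (snd z)) - snd (snd z)"
    using assms order_tendstoD(1)[OF lim(1), of 0] order_tendstoD(1)[OF lim(2), of 0] by auto
  then have "\<forall>\<^sub>F z in nhds (t, x, y). z \<in> ?K \<longrightarrow> z \<noteq> (t, x, y) \<longrightarrow>
    b (fst (snd z)) < snd (snd z) \<and> snd (snd z) < \<eta> (fst z) (fst (snd z))"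
    by (auto simp: eventually_at_filter elim: eventually_elim2)
  then show ?thesis
    by eventually_elim (use assms in auto)
qed

lemma nearby_column_slice:
  assumes "t \<in> {0..T}" "x \<in> closure M" "b x < y" "y < \<eta> t x"
  shows "\<forall>\<^sub>F (x', y') in nhds (x, y). x' \<in> closure M \<longrightarrow> b x' < y' \<and> y' < \<eta> t x'"
proof -
  have "filterlim (\<lambda>q. (t, q)) (nhds (t, x, y)) (nhds (x, y))"
    by (intro tendsto_Pair tendsto_const filterlim_ident)
  from eventually_compose_filterlim[OF nearby_column[OF assms] this]
  show ?thesis by eventually_elim (use assms in auto)
qed

lemma open_fluid_domain:
  assumes t: "t \<in> {0..T}"
  shows "open (\<Omega> t)"
proof -
  have "\<forall>\<^sub>F q in nhds p. q \<in> \<Omega> t" if "p \<in> \<Omega> t" for p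
  proof -
    obtain x y where "p = (x, y)" by fastforce
    with that have p: "p = (x, y)" "x \<in> M" "b x < y" "y < \<eta> t x"
      by (simp_all add: fluid_domain_def)
    have "\<forall>\<^sub>F q in nhds p. q \<in> M \<times> UNIV"
      using p M_open by (intro eventually_nhds_in_open open_Times) auto
    with nearby_column_slice[OF t in_closure[OF p(2)] p(3,4)] show ?thesis
      unfolding p(1) by eventually_elim (auto simp: fluid_domain_def in_closure)
  qed
  then have "\<exists>U. open U \<and> p \<in> U \<and> U \<subseteq> \<Omega> t" if "p \<in> \<Omega> t" for p
    using that unfolding eventually_nhds subset_eq by blast
  then show ?thesis by (subst open_subopen) blast
qed

text \<open>Strictly inside the column, the point is approached horizontally at constant height by
  points over \<open>M\<close>; the two ends of the column follow from closedness.\<close>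

lemma column_in_closure:
  assumes t: "t \<in> {0..T}" and x: "x \<in> closure M" and y: "b x \<le> y" "y \<le> \<eta> t x"
  shows "(x, y) \<in> closure (\<Omega> t)"
proof (rule closure_vertical_segment[OF depth[OF t x] y])
  fix y assume y: "b x < y" "y < \<eta> t x"
  obtain X where X: "\<And>n. X n \<in> M" "X \<longlonglongrightarrow> x"
    using x by (auto simp: closure_sequential)
  then have "(\<lambda>n. (X n, y)) \<longlonglongrightarrow> (x, y)" by (intro tendsto_intros)
  then have "\<forall>\<^sub>F n in sequentially. (X n, y) \<in> closure (\<Omega> t)"
    using eventually_compose_filterlim[OF nearby_column_slice[OF t x y]] X
      closure_subset[of "\<Omega> t"]
    by (fastforce simp: fluid_domain_def in_closure elim!: eventually_mono)
  then show "(x, y) \<in> closure (\<Omega> t)"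
    using Lim_in_closed_set[OF closed_closure _ _ \<open>(\<lambda>n. (X n, y)) \<longlonglongrightarrow> (x, y)\<close>] by simp
qed

lemma spacetime_column:
  assumes "t \<in> {0..T}" "x \<in> closure M" "b x \<le> y" "y \<le> \<eta> t x"
  shows "(t, x, y) \<in> Q"
  using assms column_in_closure by (simp add: closed_fluid_spacetime_def)

lemma wall_in_closure:
  assumes t: "t \<in> {0..T}" and x: "x \<in> frontier M" and y: "b x \<le> y" "y \<le> \<eta> t x"
  shows "(x, y) \<in> closure (fixed_boundary M b (\<eta> t))"
proof (rule closure_vertical_segment[OF depth[OF t frontier_in_closure[OF x]] y])
  fix y assume "b x < y" "y < \<eta> t x"
  then have "(x, y) \<in> fixed_boundary M b (\<eta> t)"
    using x by (simp add: fixed_boundary_def side_walls_def)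
  then show "(x, y) \<in> closure (fixed_boundary M b (\<eta> t))"
    using closure_subset by blast
qed

lemma closure_free_surface:
  assumes "t \<in> {0..T}"
  shows "closure (free_surface M (\<eta> t)) = {(x, y). x \<in> closure M \<and> y = \<eta> t x}"
  unfolding free_surface_def using assms by (intro closure_graph \<eta>_slice_continuous)

text \<open>The closure of the bottom is the graph of \<open>b\<close> over the closed base,
  strictly below the surface, so only the side walls can be met.\<close>

lemma contact_point:
  assumes "t \<in> {0..T}"
    "m \<in> closure (free_surface M (\<eta> t)) \<inter> closure (fixed_boundary M b (\<eta> t))"
  obtains x where "x \<in> frontier M" "m = (x, \<eta> t x)"
proof -
  obtain x where x: "x \<in> closure M" "m = (x, \<eta> t x)"
    using assms by (auto simp: closure_free_surface)
  have "m \<notin> closure (bottom M b)"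
    using closure_graph[OF b_continuous] depth[OF assms(1) x(1)] x by (auto simp: bottom_def)
  then have "m \<in> closure (side_walls M b (\<eta> t))"
    using assms by (auto simp: fixed_boundary_def)
  moreover have "closure (side_walls M b (\<eta> t)) \<subseteq> frontier M \<times> UNIV"
    by (intro closure_minimal closed_Times) (auto simp: side_walls_def)
  ultimately show thesis using that x by auto
qed

lemma contact_pointI:
  assumes "t \<in> {0..T}" "x \<in> frontier M"
  shows "(t, x, \<eta> t x) \<in> W"
proof -
  have x: "x \<in> closure M" using assms(2) by (rule frontier_in_closure)
  have "(x, \<eta> t x) \<in> closure (fixed_boundary M b (\<eta> t))"
    using wall_in_closure[OF assms, of "\<eta> t x"] depth[OF assms(1) x] by simp
  then show ?thesis
    using contact_in_W assms(1) x by (auto simp: contact_spacetime_def closure_free_surface)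
qed

lemma flat_wall_inward_closure:
  assumes "flat_wall M x d"
  shows "\<forall>\<^sub>F s in at_right 0. x + s *\<^sub>R d \<in> closure M"
  using flat_wall_inward[OF assms] by eventually_elim (rule in_closure)

section \<open>The equations on the wall and in the interior\<close>

lemma unit_normal_wall:
  assumes t: "t \<in> {0..T}" and d: "flat_wall M x d" and y: "b x < y" "y < \<eta> t x"
  shows "unit_normal (fixed_boundary M b (\<eta> t)) (x, y) (d, 0)"
proof -
  let ?S = "fixed_boundary M b (\<eta> t)"
  have x: "x \<in> closure M" using flat_wall_frontier_point[OF d] by (rule frontier_in_closure)
  have norm_d: "norm d = 1" using d by (simp add: flat_wall_def)
  have fr: "\<forall>\<^sub>F q in nhds (x, y). fst q \<in> frontier M \<longleftrightarrow> (fst q - x) \<bullet> d = 0"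
    by (rule eventually_compose_filterlim[OF flat_wall_frontier[OF d M_open]])
      (auto intro!: tendsto_eq_intros filterlim_ident)
  with nearby_column_slice[OF t x y]
  \<comment> \<open>Strictly above the bottom and below the surface, the fixed boundary coincides
    locally with a vertical plane.\<close>
  have near: "\<forall>\<^sub>F q in nhds (x, y). q \<in> ?S \<longleftrightarrow> (q - (x, y)) \<bullet> (d, 0) = 0"
    by eventually_elim
      (auto simp: fixed_boundary_def bottom_def side_walls_def frontier_in_closure dest: in_closure)
  have "orthogonal_to_surface ?S (x, y) (d, 0)"
    using near by (intro orthogonal_to_surfaceI)
      (auto simp: eventually_at_filter inner_commute elim: eventually_mono)
  moreover have "N = (d, 0) \<or> N = - (d, 0)" if N: "norm N = 1" "orthogonal_to_surface ?S (x, y) N" for N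
  proof -
    \<comment> \<open>Straight lines in that plane realise all its directions, which pins the normal
      down up to sign, as \<open>unit_normal\<close> demands.\<close>
    have tangent: "N \<bullet> u = 0" if u: "u \<bullet> (d, 0) = 0" for u
    proof (rule orthogonal_to_surfaceD[where \<gamma>="\<lambda>s. (x, y) + (s - 0) *\<^sub>R u" and s=0])
      let ?\<gamma> = "\<lambda>s. (x, y) + (s - 0) *\<^sub>R u"
      show "orthogonal_to_surface ?S (?\<gamma> 0) N" using N by simp
      show "(?\<gamma> has_vector_derivative u) (at 0 within UNIV)"
        by (rule has_vector_derivative_line)
      show "\<forall>\<^sub>F s in at 0. ?\<gamma> s \<in> ?S"
        using eventually_compose_filterlim[OF near tendsto_line[of "(x, y)" 0 u UNIV]]
        by eventually_elim (simp add: u)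
    qed simp
    have "N = (N \<bullet> (d, 0)) *\<^sub>R (d, 0)"
      by (intro horizontal_decomposition norm_d tangent) (simp_all add: ey_def flip: zero_prod_def)
    then obtain c where c: "N = c *\<^sub>R (d, 0)" by blast
    then have "\<bar>c\<bar> = 1" using N(1) norm_d by (simp add: norm_Pair)
    then have "c = 1 \<or> c = -1" by arith
    then show ?thesis using c by auto
  qed
  ultimately show ?thesis
    using norm_d by (simp add: unit_normal_def norm_Pair)
qed

lemma wall_velocity:
  assumes "t \<in> {0..T}" "flat_wall M x d" "b x < y" "y < \<eta> t x"
  shows "v t (x, y) \<bullet> (d, 0) = 0"
proof (rule no_penetration)
  show "(x, y) \<in> fixed_boundary M b (\<eta> t)"
    using assms flat_wall_frontier_point by (simp add: fixed_boundary_def side_walls_def)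
qed (rule assms(1) unit_normal_wall[OF assms])+

text \<open>The curve followed has velocity \<open>(1, v)\<close> in spacetime; since \<open>v\<close> is tangent to the flat wall,
  it stays inside the wall, where the normal component of \<open>v\<close> vanishes.\<close>

lemma wall_material_derivative:
  assumes t: "t \<in> {0..T}" and d: "flat_wall M x d" and y: "b x < y" "y < \<eta> t x"
    and W: "(t, x, y) \<in> W"
  shows "v' (t, x, y) (1, v t (x, y)) \<bullet> (d, 0) = 0"
proof -
  define u where "u = v t (x, y)"
  \<comment> \<open>A straight line with the velocity frozen at time \<open>t\<close>: the chain
    rule sees only the velocity at \<open>s = t\<close>, so no particle trajectory has to be
    constructed.\<close>
  define \<gamma> where "\<gamma> s = (s, (x, y) + (s - t) *\<^sub>R u)" for s
  have x: "x \<in> closure M" using flat_wall_frontier_point[OF d] by (rule frontier_in_closure)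
  have u: "u \<bullet> (d, 0) = 0" unfolding u_def using assms by (intro wall_velocity)
  have \<gamma>_deriv: "(\<gamma> has_vector_derivative (1, u)) (at t within {0..T})"
    unfolding \<gamma>_def[abs_def]
    by (intro has_vector_derivative_Pair has_vector_derivative_line has_vector_derivative_id)
  have lim: "((\<lambda>s. (x, y) + (s - t) *\<^sub>R u) \<longlongrightarrow> (x, y)) (at t within {0..T})"
    by (rule tendsto_line)
  have lim_x: "((\<lambda>s. x + (s - t) *\<^sub>R fst u) \<longlongrightarrow> x) (at t within {0..T})"
    by (rule tendsto_line)
  have "(\<gamma> \<longlongrightarrow> (t, x, y)) (at t within {0..T})"
    unfolding \<gamma>_def[abs_def] by (intro tendsto_Pair tendsto_ident_at lim)
  note near = eventually_compose_filterlim[OF nearby_column[OF t x y] this]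
  have in_T: "\<forall>\<^sub>F s in at t within {0..T}. s \<in> {0..T}"
    by (simp add: eventually_at_filter)
  have wall: "\<forall>\<^sub>F s in at t within {0..T}. \<gamma> s \<in> Q \<and> v s (snd (\<gamma> s)) \<bullet> (d, 0) = 0"
    using near in_T eventually_compose_filterlim[OF flat_wall_nearby[OF d] lim_x]
  proof eventually_elim
    case (elim s)
    let ?x = "x + (s - t) *\<^sub>R fst u" and ?y = "y + (s - t) * snd u"
    have "fst u \<bullet> d = 0" using u by (simp add: inner_prod_def)
    then have flat: "flat_wall M ?x d" using elim by simp
    then have "?x \<in> closure M" by (intro frontier_in_closure flat_wall_frontier_point)
    with elim have "b ?x < ?y" "?y < \<eta> s ?x" by (auto simp: \<gamma>_def case_prod_unfold)
    moreover have "\<gamma> s = (s, ?x, ?y)" by (simp add: \<gamma>_def prod_eq_iff)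
    ultimately show ?case
      using spacetime_column[OF elim(2) \<open>?x \<in> closure M\<close>, of ?y] wall_velocity[OF elim(2) flat] by simp
  qed
  have "((\<lambda>s. (\<lambda>(t, p). v t p) (\<gamma> s)) has_vector_derivative v' (t, x, y) (1, u)) (at t within {0..T})"
  proof (rule has_vector_derivative_compose_eventually[OF _ \<gamma>_deriv])
    show "((\<lambda>(t, p). v t p) has_derivative v' (t, x, y)) (at (\<gamma> t) within Q)"
      using v_deriv[OF W] by (simp add: \<gamma>_def)
    show "\<forall>\<^sub>F s in at t within {0..T}. \<gamma> s \<in> Q"
      using wall by eventually_elim simp
  qed
  then have "((\<lambda>s. v s (snd (\<gamma> s))) has_vector_derivative v' (t, x, y) (1, u)) (at t within {0..T})"
    by (simp add: \<gamma>_def case_prod_unfold)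
  then have "((\<lambda>s. v s (snd (\<gamma> s)) \<bullet> (d, 0)) has_vector_derivative v' (t, x, y) (1, u) \<bullet> (d, 0)) (at t within {0..T})"
    by (rule bounded_linear.has_vector_derivative[OF bounded_linear_inner_left])
  then have "v' (t, x, y) (1, u) \<bullet> (d, 0) = 0"
    by (rule has_vector_derivative_eventually_const)
      (use wall at_within_Icc_neq_bot[OF t T_pos] in \<open>auto elim: eventually_mono\<close>)
  then show ?thesis by (simp add: u_def)
qed

text \<open>By linearity of \<open>v'\<close>, the time derivative and the convective term merge
  into the derivative of \<open>v\<close> in the spacetime direction \<open>(1, v)\<close>. Gravity
  drops out because \<open>(d, 0)\<close> is horizontal.\<close>

lemma interior_momentum:
  assumes t: "t \<in> {0..T}" and p: "p \<in> \<Omega> t"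
  shows "v' (t, p) (1, v t p) \<bullet> (d, 0) + P' (t, p) (d, 0) = 0"
proof -
  have W: "(t, p) \<in> W" using fluid_in_W t p by (auto simp: fluid_spacetime_def)
  obtain x y where "p = (x, y)" by fastforce
  with p have xy: "p = (x, y)" "x \<in> M" "b x < y" "y < \<eta> t x"
    by (simp_all add: fluid_domain_def)
  have \<Omega>: "open (\<Omega> t)" using t by (rule open_fluid_domain)
  have x: "x \<in> closure M" using xy in_closure by simp
  have "((\<lambda>s. (s, p)) \<longlongrightarrow> (t, x, y)) (at t within {0..T})"
    unfolding xy by (intro tendsto_intros)
  from eventually_compose_filterlim[OF nearby_column[OF t x xy(3,4)] this]
  have "\<forall>\<^sub>F s in at t within {0..T}. s \<in> {0..T} \<longrightarrow> (s, p) \<in> Q"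
    by eventually_elim (use x spacetime_column in \<open>auto simp: xy less_imp_le\<close>)
  then have in_Q: "\<forall>\<^sub>F s in at t within {0..T}. (s, p) \<in> Q"
    by (auto simp: eventually_at_filter elim: eventually_mono)
  have "((\<lambda>s. (\<lambda>(t, p). v t p) (s, p)) has_vector_derivative v' (t, p) (1, 0)) (at t within {0..T})"
  proof (rule has_vector_derivative_compose_eventually[where \<gamma>="\<lambda>s. (s, p)", OF v_deriv[OF W] _ in_Q])
    show "((\<lambda>s. (s, p)) has_vector_derivative (1, 0)) (at t within {0..T})"
      by (intro has_vector_derivative_Pair has_vector_derivative_const has_vector_derivative_id)
  qed
  then have dt: "time_deriv T (\<lambda>s. v s p) t = v' (t, p) (1, 0)"
    unfolding time_deriv_def
    by (intro vector_derivative_within at_within_Icc_neq_bot t T_pos) simp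
  have "(v t has_derivative (\<lambda>h. v' (t, p) (0, h))) (at p within \<Omega> t)"
  proof -
    have "((\<lambda>q. (t, q)) has_derivative (\<lambda>h. (0, h))) (at p within \<Omega> t)"
      by (intro has_derivative_Pair has_derivative_const has_derivative_ident)
    moreover have "(\<lambda>q. (t, q)) ` \<Omega> t \<subseteq> Q"
      using t closure_subset[of "\<Omega> t"] by (auto simp: closed_fluid_spacetime_def)
    ultimately have "((\<lambda>q. (\<lambda>(t, p). v t p) (t, q)) has_derivative (\<lambda>h. v' (t, p) (0, h))) (at p within \<Omega> t)"
      by (intro has_derivative_in_compose[of "\<lambda>q. (t, q)" _ p _ "\<lambda>(t, p). v t p"]
          has_derivative_subset[OF v_deriv[OF W]])
    then show ?thesis by simp
  qed
  then have "(v t has_derivative (\<lambda>h. v' (t, p) (0, h))) (at p)"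
    using at_within_open[OF p \<Omega>] by simp
  then have conv: "convective (v t) p = v' (t, p) (0, v t p)"
    unfolding convective_def by (metis frechet_derivative_at)
  \<comment> \<open>\<open>P'\<close> is a derivative within the closed domain, whereas
    \<open>grad\<close> refers to the full one; they agree at interior points.\<close>
  have "at p within closure (\<Omega> t) = at p"
    using p \<Omega> interior_maximal[OF closure_subset \<Omega>] by (intro at_within_interior) auto
  then have "grad (P t) p \<bullet> (d, 0) = P' (t, p) (d, 0)"
    using P_deriv[OF W] by (intro grad_inner) simp
  moreover have "v' (t, p) (1, v t p) = v' (t, p) (1, 0) + v' (t, p) (0, v t p)"
    by (subst blinfun.add_right[symmetric]) simp
  moreover have "(time_deriv T (\<lambda>s. v s p) t + convective (v t) p + grad (P t) p) \<bullet> (d, 0) = 0"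
    unfolding momentum[OF t p] by (simp add: ey_def zero_prod_def[symmetric])
  ultimately show ?thesis
    by (simp add: dt conv inner_add_left)
qed

section \<open>Pressure gradient and slope of the free surface at a contact point\<close>

lemma continuous_on_v: "continuous_on W (\<lambda>(t, p). v t p)"
proof (rule has_derivative_continuous_on)
  fix z assume "z \<in> W"
  from has_derivative_subset[OF v_deriv[OF this] openin_imp_subset[OF W_open]]
  show "((\<lambda>(t, p). v t p) has_derivative v' z) (at z within W)" .
qed

lemma continuous_on_material_derivative:
  "continuous_on W (\<lambda>z. v' z (1, (\<lambda>(t, p). v t p) z) \<bullet> (d, 0))"
  by (intro continuous_on_inner continuous_on_const continuous_on_Pair continuous_on_v v'_continuous
      bounded_bilinear.continuous_on[OF bounded_bilinear_blinfun_apply])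

text \<open>Two limits at the same point: from the interior at fixed time, the normal acceleration
  plus the normal pressure derivative vanishes; from the wall vertically below, the normal
  acceleration alone vanishes.\<close>

lemma contact_pressure_derivative:
  assumes t: "t \<in> {0..T}" and d: "flat_wall M x d"
  shows "P' (t, x, \<eta> t x) (d, 0) = 0"
proof -
  let ?z = "(t, x, \<eta> t x)"
  have fr: "x \<in> frontier M" using d by (rule flat_wall_frontier_point)
  then have x: "x \<in> closure M" by (rule frontier_in_closure)
  have z: "?z \<in> W" using t fr by (rule contact_pointI)
  have "v' ?z (1, (\<lambda>(t, p). v t p) ?z) \<bullet> (d, 0) + P' ?z (d, 0) = 0"
  proof (rule continuous_on_closure_const[where A="{t} \<times> \<Omega> t" and W=W])
    show "continuous_on W (\<lambda>z. v' z (1, (\<lambda>(t, p). v t p) z) \<bullet> (d, 0) + P' z (d, 0))"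
      by (intro continuous_on_add continuous_on_const continuous_on_material_derivative P'_continuous
          bounded_bilinear.continuous_on[OF bounded_bilinear_blinfun_apply])
    show "{t} \<times> \<Omega> t \<subseteq> W" using fluid_in_W t by (auto simp: fluid_spacetime_def)
    show "?z \<in> closure ({t} \<times> \<Omega> t)"
      using column_in_closure[OF t x, of "\<eta> t x"] depth[OF t x] by (simp add: closure_Times)
  next
    fix w assume "w \<in> {t} \<times> \<Omega> t"
    then obtain p where "w = (t, p)" "p \<in> \<Omega> t" by blast
    then show "v' w (1, (\<lambda>(t, p). v t p) w) \<bullet> (d, 0) + P' w (d, 0) = 0"
      using interior_momentum[OF t] by simp
  qed (rule z)
  moreover have "v' ?z (1, (\<lambda>(t, p). v t p) ?z) \<bullet> (d, 0) = 0"
  proof (rule continuous_on_closure_const[where A="W \<inter> {t} \<times> {x} \<times> {b x<..<\<eta> t x}" and W=W,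
        OF continuous_on_material_derivative])
    \<comment> \<open>Wall points are known to lie in \<open>W\<close> only near the contact point.
      Openness of \<open>W\<close> relative to \<open>Q\<close> ensures that those in
      \<open>W\<close> still accumulate there.\<close>
    obtain U where U: "open U" "W = Q \<inter> U" using W_open by (auto simp: openin_open)
    have "?z \<in> U \<inter> closure ({t} \<times> {x} \<times> {b x<..<\<eta> t x})"
      using z U depth[OF t x] by (simp add: closure_Times)
    then have "?z \<in> closure (U \<inter> {t} \<times> {x} \<times> {b x<..<\<eta> t x})"
      using open_Int_closure_subset[OF U(1)] by blast
    moreover have "{t} \<times> {x} \<times> {b x<..<\<eta> t x} \<subseteq> Q"
      using spacetime_column[OF t x] by auto
    ultimately show "?z \<in> closure (W \<inter> {t} \<times> {x} \<times> {b x<..<\<eta> t x})"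
      using U(2) by (simp add: Int_absorb1 Int_assoc Int_left_commute)
  next
    fix w assume "w \<in> W \<inter> {t} \<times> {x} \<times> {b x<..<\<eta> t x}"
    then obtain y where "w = (t, x, y)" "w \<in> W" "b x < y" "y < \<eta> t x" by auto
    then show "v' w (1, (\<lambda>(t, p). v t p) w) \<bullet> (d, 0) = 0"
      using wall_material_derivative[OF t d] by simp
  qed (use z in auto)
  ultimately show ?thesis by simp
qed

lemma contact_pressure_vertical_derivative:
  assumes t: "t \<in> {0..T}" and x: "x \<in> frontier M"
  shows "P' (t, x, \<eta> t x) ey = - a t x"
proof -
  have xc: "x \<in> closure M" using x by (rule frontier_in_closure)
  note lt = depth[OF t xc]
  have "((\<lambda>y. P t (x, y)) has_vector_derivative P' (t, x, \<eta> t x) (0, 1)) (at (\<eta> t x) within {b x..\<eta> t x})"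
  proof (rule has_vector_derivative_compose_eventually[where f="P t" and \<gamma>="\<lambda>y. (x, y)"])
    show "(P t has_derivative P' (t, x, \<eta> t x)) (at (x, \<eta> t x) within closure (\<Omega> t))"
      by (intro P_deriv contact_pointI t x)
    show "(Pair x has_vector_derivative (0, 1)) (at (\<eta> t x) within {b x..\<eta> t x})"
      by (intro has_vector_derivative_Pair has_vector_derivative_const has_vector_derivative_id)
    show "\<forall>\<^sub>F y in at (\<eta> t x) within {b x..\<eta> t x}. (x, y) \<in> closure (\<Omega> t)"
      using column_in_closure[OF t xc] by (simp add: eventually_at_filter)
  qed
  moreover have "at (\<eta> t x) within {b x..\<eta> t x} \<noteq> bot"
    using lt by (intro at_within_Icc_neq_bot) auto
  ultimately show ?thesis
    using vector_derivative_unique_within taylor[OF t xc]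
    by (fastforce simp: has_real_derivative_iff_has_vector_derivative ey_def zero_prod_def)
qed

text \<open>Half-lines suffice: the direction \<open>u\<close> will point into \<open>M\<close>,
  along a flat wall, or along an edge starting at a corner.\<close>

lemma surface_curve_derivative:
  assumes t: "t \<in> {0..T}" and x: "x \<in> closure M"
    and u: "\<forall>\<^sub>F s in at_right 0. x + s *\<^sub>R u \<in> closure M"
  shows "((\<lambda>s. (x + s *\<^sub>R u, \<eta> t (x + s *\<^sub>R u))) has_vector_derivative (u, \<eta>' (t, x) (0, u))) (at_right 0)"
proof -
  have line: "((\<lambda>s. x + s *\<^sub>R u) has_vector_derivative u) (at_right 0)"
    using has_vector_derivative_line[of x 0 u] by simp
  have "((\<lambda>s. (\<lambda>(t, x). \<eta> t x) (t, x + s *\<^sub>R u)) has_vector_derivative \<eta>' (t, x) (0, u)) (at_right 0)"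
  proof (rule has_vector_derivative_compose_eventually[where \<gamma>="\<lambda>s. (t, x + s *\<^sub>R u)"])
    show "((\<lambda>(t, x). \<eta> t x) has_derivative \<eta>' (t, x)) (at (t, x + 0 *\<^sub>R u) within {0..T} \<times> closure M)"
      using \<eta>_deriv[of "(t, x)"] t x by simp
    show "\<forall>\<^sub>F s in at_right 0. (t, x + s *\<^sub>R u) \<in> {0..T} \<times> closure M"
      using u by eventually_elim (use t in simp)
  qed (intro has_vector_derivative_Pair has_vector_derivative_const line)
  then show ?thesis by (intro has_vector_derivative_Pair line) simp
qed

lemma contact_slope:
  assumes t: "t \<in> {0..T}" and d: "flat_wall M x d"
  shows "\<eta>' (t, x) (0, d) = 0"
proof -
  have fr: "x \<in> frontier M" using d by (rule flat_wall_frontier_point)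
  then have x: "x \<in> closure M" by (rule frontier_in_closure)
  let ?m = "(x, \<eta> t x)" and ?\<gamma> = "\<lambda>s. (x + s *\<^sub>R d, \<eta> t (x + s *\<^sub>R d))"
  note inward = flat_wall_inward[OF d]
  note inward' = flat_wall_inward_closure[OF d]
  note \<gamma> = surface_curve_derivative[OF t x inward']
  have P_deriv': "(P t has_derivative P' (t, ?m)) (at ?m within closure (\<Omega> t))"
    by (intro P_deriv contact_pointI t fr)
  have \<gamma>_in: "\<forall>\<^sub>F s in at_right 0. ?\<gamma> s \<in> closure (\<Omega> t)"
    using inward' by eventually_elim (use column_in_closure[OF t] depth[OF t] in \<open>auto simp: less_imp_le\<close>)
  have deriv: "((\<lambda>s. P t (?\<gamma> s)) has_vector_derivative P' (t, ?m) (d, \<eta>' (t, x) (0, d))) (at_right 0)"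
    by (rule has_vector_derivative_compose_eventually[OF _ \<gamma> \<gamma>_in]) (use P_deriv' in simp)
  have P0: "\<forall>\<^sub>F s in at_right 0. P t (?\<gamma> s) = 0"
    using inward by eventually_elim (use P_surface[OF t] in \<open>simp add: free_surface_def\<close>)
  have "P' (t, ?m) (d, \<eta>' (t, x) (0, d)) = 0"
    using deriv P0 trivial_limit_at_right_real by (rule has_vector_derivative_eventually_const)
  moreover have "(d, \<eta>' (t, x) (0, d)) = (d, 0) + \<eta>' (t, x) (0, d) *\<^sub>R ey"
    by (simp add: ey_def zero_prod_def[symmetric])
  ultimately show ?thesis
    using contact_pressure_derivative[OF t d] contact_pressure_vertical_derivative[OF t fr]
      taylor_nonzero[OF t x] by (simp add: blinfun.add_right blinfun.scaleR_right)
qed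

section \<open>Normals at a contact point\<close>

lemma surface_normal_at_contact:
  assumes t: "t \<in> {0..T}" and d: "flat_wall M x d"
    and \<nu>: "orthogonal_to_surface (closure (free_surface M (\<eta> t))) (x, \<eta> t x) \<nu>"
  shows "\<nu> \<bullet> (d, 0) = 0"
proof -
  have x: "x \<in> closure M" using flat_wall_frontier_point[OF d] by (rule frontier_in_closure)
  note inward = flat_wall_inward_closure[OF d]
  have "\<nu> \<bullet> (d, \<eta>' (t, x) (0, d)) = 0"
  proof (rule orthogonal_to_surfaceD[OF _ surface_curve_derivative[OF t x inward]])
    show "\<forall>\<^sub>F s in at_right 0. (x + s *\<^sub>R d, \<eta> t (x + s *\<^sub>R d)) \<in> closure (free_surface M (\<eta> t))"
      using inward by eventually_elim (simp add: closure_free_surface[OF t])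
  qed (use \<nu> in auto)
  then show ?thesis using contact_slope[OF t d] by simp
qed

lemma wall_normal_horizontal:
  assumes t: "t \<in> {0..T}" and x: "x \<in> frontier M"
    and N: "orthogonal_to_surface (closure (fixed_boundary M b (\<eta> t))) (x, \<eta> t x) N"
  shows "N \<bullet> ey = 0"
proof -
  have lt: "b x < \<eta> t x" using t x by (intro depth frontier_in_closure)
  \<comment> \<open>The curve descends, since the wall ends at the surface.\<close>
  let ?\<gamma> = "\<lambda>s. (x, \<eta> t x) + (s - 0) *\<^sub>R - ey"
  have "N \<bullet> - ey = 0"
  proof (rule orthogonal_to_surfaceD[where \<gamma>="\<lambda>s. (x, \<eta> t x) + (s - 0) *\<^sub>R - ey" and s=0])
    show "orthogonal_to_surface (closure (fixed_boundary M b (\<eta> t))) (?\<gamma> 0) N" using N by simp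
    show "(?\<gamma> has_vector_derivative - ey) (at_right 0)" by (rule has_vector_derivative_line)
    have "\<forall>\<^sub>F s in at_right 0. s \<in> {0<..<\<eta> t x - b x}"
      using lt by (intro eventually_at_right_real) simp
    then show "\<forall>\<^sub>F s in at_right 0. ?\<gamma> s \<in> closure (fixed_boundary M b (\<eta> t))"
      by eventually_elim (use wall_in_closure[OF t x] in \<open>simp add: ey_def zero_prod_def[symmetric]\<close>)
  qed simp
  then show ?thesis by simp
qed

text \<open>A horizontal line from the contact point may rise above the surface and so leave the
  wall. The curve therefore follows the contact line, and \<open>wall_normal_horizontal\<close>
  removes the vertical part of its velocity.\<close>

lemma wall_normal_tangent:
  assumes t: "t \<in> {0..T}" and x: "x \<in> frontier M"
    and N: "orthogonal_to_surface (closure (fixed_boundary M b (\<eta> t))) (x, \<eta> t x) N"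
    and u: "\<forall>\<^sub>F s in at_right 0. x + s *\<^sub>R u \<in> frontier M"
  shows "N \<bullet> (u, 0) = 0"
proof -
  have "N \<bullet> (u, \<eta>' (t, x) (0, u)) = 0"
  proof (rule orthogonal_to_surfaceD[OF _ surface_curve_derivative[OF t]])
    show "\<forall>\<^sub>F s in at_right 0. (x + s *\<^sub>R u, \<eta> t (x + s *\<^sub>R u)) \<in> closure (fixed_boundary M b (\<eta> t))"
      using u by eventually_elim
        (use wall_in_closure[OF t] depth[OF t] frontier_in_closure in \<open>auto simp: less_imp_le\<close>)
    show "\<forall>\<^sub>F s in at_right 0. x + s *\<^sub>R u \<in> closure M"
      using u by eventually_elim (rule frontier_in_closure)
  qed (use N x frontier_in_closure in auto)
  moreover have "(u, \<eta>' (t, x) (0, u)) = (u, 0) + \<eta>' (t, x) (0, u) *\<^sub>R ey"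
    by (simp add: ey_def zero_prod_def[symmetric])
  ultimately show ?thesis
    using wall_normal_horizontal[OF t x N] by (simp add: inner_add_right)
qed

text \<open>The vertical and the horizontal wall tangents force \<open>n\<close> to be a multiple of
  \<open>(d, 0)\<close>, which is itself tangent to the free surface because the slope in direction
  \<open>d\<close> is zero.\<close>

lemma right_angle:
  assumes t: "t \<in> {0..T}" and d: "flat_wall M x d"
    and n: "orthogonal_to_surface (closure (fixed_boundary M b (\<eta> t))) (x, \<eta> t x) n"
    and \<nu>: "orthogonal_to_surface (closure (free_surface M (\<eta> t))) (x, \<eta> t x) \<nu>"
  shows "n \<bullet> \<nu> = 0"
proof -
  have fr: "x \<in> frontier M" using d by (rule flat_wall_frontier_point)
  have "((\<lambda>s. x + s *\<^sub>R rot d) \<longlongrightarrow> x) (at_right 0)"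
    using tendsto_line[of x 0 "rot d"] by simp
  from eventually_compose_filterlim[OF flat_wall_frontier[OF d M_open] this]
  have "\<forall>\<^sub>F s in at_right 0. x + s *\<^sub>R rot d \<in> frontier M"
    by eventually_elim simp
  then have "n \<bullet> (rot d, 0) = 0" by (rule wall_normal_tangent[OF t fr n])
  then have "n = (n \<bullet> (d, 0)) *\<^sub>R (d, 0)"
    using d wall_normal_horizontal[OF t fr n]
    by (intro horizontal_decomposition) (auto simp: flat_wall_def)
  then show ?thesis
    using surface_normal_at_contact[OF t d \<nu>] by (metis inner_commute inner_scaleR_left mult_zero_right)
qed

end

subsection \<open>Canal and rectangular basin\<close>

lemma flat_wallI:
  assumes "norm d = 1" "open U" "x \<in> U" "\<And>x'. x' \<in> U \<Longrightarrow> x' \<in> M \<longleftrightarrow> 0 < (x' - x) \<bullet> d"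
  shows "flat_wall M x d"
  unfolding flat_wall_def using assms eventually_nhds_in_open[of U x] by (auto elim!: eventually_mono)

text \<open>The sign \<open>\<sigma>\<close> makes the normal point inwards: 1 at
  \<open>x1 = 0\<close> and -1 at \<open>x1 = 1\<close>. Each neighbourhood used stops short of the
  opposite wall.\<close>

lemma flat_wall_first:
  assumes "x1 \<in> {0, 1::real}" "open I" "x2 \<in> I"
  shows "\<exists>\<sigma>. \<bar>\<sigma>\<bar> = 1 \<and> flat_wall ({0<..<1} \<times> I) (x1, x2) (\<sigma>, 0)"
proof (cases "x1 = 0")
  case True
  have "flat_wall ({0<..<1} \<times> I) (x1, x2) (1, 0)"
    by (rule flat_wallI[of _ "{..<1} \<times> I"]) (use assms True in \<open>auto simp: open_Times norm_Pair\<close>)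
  then show ?thesis by (intro exI[of _ 1]) simp
next
  case False
  have "flat_wall ({0<..<1} \<times> I) (x1, x2) (- 1, 0)"
    by (rule flat_wallI[of _ "{0<..} \<times> I"]) (use assms False in \<open>auto simp: open_Times norm_Pair\<close>)
  then show ?thesis by (intro exI[of _ "- 1"]) simp
qed

lemma flat_wall_second:
  fixes L :: real
  assumes "x1 \<in> {0<..<1::real}" "x2 \<in> {0, L}" "0 < L"
  shows "\<exists>\<sigma>. flat_wall ({0<..<1} \<times> {0<..<L}) (x1, x2) (0, \<sigma>)"
proof (cases "x2 = 0")
  case True
  have "flat_wall ({0<..<1} \<times> {0<..<L}) (x1, x2) (0, 1)"
    by (rule flat_wallI[of _ "{0<..<1} \<times> {..<L}"]) (use assms True in \<open>auto simp: open_Times norm_Pair\<close>)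
  then show ?thesis ..
next
  case False
  have "flat_wall ({0<..<1} \<times> {0<..<L}) (x1, x2) (0, - 1)"
    by (rule flat_wallI[of _ "{0<..<1} \<times> {0<..}"]) (use assms False in \<open>auto simp: open_Times norm_Pair\<close>)
  then show ?thesis ..
qed

lemma frontier_rectangle:
  fixes I :: "real set"
  assumes I: "open I"
  shows "frontier ({0<..<1} \<times> I) = ({0..1::real} \<times> closure I) - ({0<..<1} \<times> I)"
  using I by (simp add: frontier_def closure_Times interior_open open_Times)

lemma eventually_inward:
  fixes a b c :: real
  assumes "c \<in> {a, b}" "a < b"
  shows "\<exists>\<sigma>. \<sigma> \<noteq> 0 \<and> (\<forall>\<^sub>F s in at_right 0. c + s * \<sigma> \<in> {a<..<b})"
proof -
  have "\<forall>\<^sub>F s in at_right 0. s \<in> {0<..<b - a}"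
    using assms by (intro eventually_at_right_real) simp
  then have "\<forall>\<^sub>F s in at_right 0. c + s * (if c = a then 1 else - 1) \<in> {a<..<b}"
    by eventually_elim (use assms in auto)
  then show ?thesis by (intro exI[of _ "if c = a then 1 else - 1"]) simp
qed

text \<open>The two edges and the vertical give three independent directions tangent to the fixed
  boundary, and only the zero vector is orthogonal to all of them.\<close>

lemma (in contact_flow) no_normal_at_corner:
  assumes M: "M = {0<..<1} \<times> {0<..<L}" and L: "0 < L" and t: "t \<in> {0..T}"
    and x: "x1 \<in> {0, 1}" "x2 \<in> {0, L}"
    and n: "orthogonal_to_surface (closure (fixed_boundary M b (\<eta> t))) ((x1, x2), \<eta> t (x1, x2)) n"
  shows "n = 0"
proof -
  have fr: "frontier M = {0..1} \<times> {0..L} - {0<..<1} \<times> {0<..<L}"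
    using L by (simp add: M frontier_rectangle)
  have corner: "(x1, x2) \<in> frontier M" using x L by (auto simp: fr)
  obtain \<sigma> \<tau> where \<sigma>: "\<sigma> \<noteq> 0" "\<forall>\<^sub>F s in at_right 0. x1 + s * \<sigma> \<in> {0<..<1}"
    and \<tau>: "\<tau> \<noteq> 0" "\<forall>\<^sub>F s in at_right 0. x2 + s * \<tau> \<in> {0<..<L}"
    using eventually_inward[of x1 0 1] eventually_inward[of x2 0 L] x L by auto
  have "n \<bullet> ((\<sigma>, 0), 0) = 0"
    by (rule wall_normal_tangent[OF t corner n])
      (use \<sigma>(2) in eventually_elim, use x L in \<open>auto simp: fr\<close>)
  moreover have "n \<bullet> ((0, \<tau>), 0) = 0"
    by (rule wall_normal_tangent[OF t corner n])
      (use \<tau>(2) in eventually_elim, use x L in \<open>auto simp: fr\<close>)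
  ultimately show ?thesis
    using wall_normal_horizontal[OF t corner n] \<sigma>(1) \<tau>(1)
    by (auto simp: ey_def inner_prod_def prod_eq_iff)
qed

theorem proposition6p1:
  fixes I :: "real set" and M :: "R2 set" and T g h :: real
    and b :: "R2 \<Rightarrow> real" and \<eta> :: "real \<Rightarrow> R2 \<Rightarrow> real"
    and v :: "real \<Rightarrow> R3 \<Rightarrow> R3" and P :: "real \<Rightarrow> R3 \<Rightarrow> real" and a :: "real \<Rightarrow> R2 \<Rightarrow> real"
  assumes I: "I = UNIV \<or> (\<exists>L>0. I = {0<..<L})"
    and M: "M = {0<..<1} \<times> I"
    and "T > 0" and "g > 0"
    and b: "continuous_on (closure M) b"
    and sol: "classical_solution M T g b \<eta> v P"
    and a_taylor: "\<And>t x. t \<in> {0..T} \<Longrightarrow> x \<in> closure M \<Longrightarrow>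
        ((\<lambda>y. P t (x, y)) has_real_derivative (- a t x)) (at (\<eta> t x) within {b x..\<eta> t x})"
    and a_cont: "continuous_on ({0..T} \<times> closure M) (\<lambda>(t, x). a t x)"
    and a_nonzero: "\<And>t x. t \<in> {0..T} \<Longrightarrow> x \<in> closure M \<Longrightarrow> a t x \<noteq> 0"
    and "h > 0"
    and depth: "\<And>t x. t \<in> {0..T} \<Longrightarrow> x \<in> M \<Longrightarrow> \<eta> t x \<ge> b x + h"
  shows "(\<forall>t\<in>{0..T}.
            \<forall>m\<in>closure (free_surface M (\<eta> t)) \<inter> closure (fixed_boundary M b (\<eta> t)).
            \<forall>n \<nu>. unit_normal (closure (fixed_boundary M b (\<eta> t))) m n \<and>
                   unit_normal (closure (free_surface M (\<eta> t))) m \<nu> \<longrightarrow> n \<bullet> \<nu> = 0) \<and>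
         (\<forall>t\<in>{0..T}. \<forall>x1\<in>{0, 1}. \<forall>x2\<in>I.
            (\<forall>n \<nu>. unit_normal (closure (fixed_boundary M b (\<eta> t))) ((x1, x2), \<eta> t (x1, x2)) n \<and>
                   unit_normal (closure (free_surface M (\<eta> t))) ((x1, x2), \<eta> t (x1, x2)) \<nu> \<longrightarrow>
                   n \<bullet> \<nu> = 0) \<longleftrightarrow>
            ((\<lambda>s. \<eta> t (s, x2)) has_real_derivative 0) (at x1 within {0..1}))"
proof -
  have I_open: "open I" using I by auto
  have flow: "regular_flow M T b \<eta> v P"
    using sol by (simp add: classical_solution_def)
  then have C1_\<eta>: "C1_within ({0..T} \<times> closure M) ({0..T} \<times> closure M) (\<lambda>(t, x). \<eta> t x)"
    unfolding regular_flow_def by (rule conjunct1)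
  obtain \<eta>' where \<eta>': "\<And>z. z \<in> {0..T} \<times> closure M \<Longrightarrow>
      ((\<lambda>(t, x). \<eta> t x) has_derivative blinfun_apply (\<eta>' z)) (at z within {0..T} \<times> closure M)"
    using C1_\<eta> unfolding C1_within_def by metis
  obtain W and P' :: "real \<times> R3 \<Rightarrow> R3 \<Rightarrow>\<^sub>L real"
    where W: "openin (top_of_set (closed_fluid_spacetime M T b \<eta>)) W"
      "fluid_spacetime M T b \<eta> \<subseteq> W" "contact_spacetime M T b \<eta> \<subseteq> W"
    and C1_v: "C1_within W (closed_fluid_spacetime M T b \<eta>) (\<lambda>(t, p). v t p)"
    and P'_cont: "continuous_on W P'"
    and P'_deriv: "\<forall>(t, p)\<in>W. (P t has_derivative blinfun_apply (P' (t, p)))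
      (at p within closure (fluid_domain M b (\<eta> t)))"
    using flow unfolding regular_flow_def by (elim conjE exE) (rule that)
  have P': "(P t has_derivative blinfun_apply (P' (t, p))) (at p within closure (fluid_domain M b (\<eta> t)))"
    if "(t, p) \<in> W" for t p
    using bspec[OF P'_deriv that] by simp
  obtain v' where v': "\<And>z. z \<in> W \<Longrightarrow>
      ((\<lambda>(t, p). v t p) has_derivative blinfun_apply (v' z)) (at z within closed_fluid_spacetime M T b \<eta>)"
      "continuous_on W v'"
    using C1_v unfolding C1_within_def by metis
  have euler:
    "time_deriv T (\<lambda>s. v s p) t + convective (v t) p + grad (P t) p = - g *\<^sub>R ey"
    if "t \<in> {0..T}" "p \<in> fluid_domain M b (\<eta> t)" for t p
    using sol that unfolding classical_solution_def by blast
  have no_flux: "v t m \<bullet> n = 0"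
    if "t \<in> {0..T}" "m \<in> fixed_boundary M b (\<eta> t)" "unit_normal (fixed_boundary M b (\<eta> t)) m n" for t m n
    using sol that unfolding classical_solution_def by blast
  have zero_pressure: "P t m = 0" if "t \<in> {0..T}" "m \<in> free_surface M (\<eta> t)" for t m
    using sol that unfolding classical_solution_def by blast
  interpret contact_flow M T g h b \<eta> v P a \<eta>' W v' P'
  proof
    show "open M" using I_open by (simp add: M open_Times)
  qed (fact assms \<eta>' W v' P' P'_cont euler no_flux zero_pressure)+
  have wall: "\<exists>\<sigma>. \<bar>\<sigma>\<bar> = 1 \<and> flat_wall M (x1, x2) (\<sigma>, 0)" if "x1 \<in> {0, 1}" "x2 \<in> I" for x1 x2
    unfolding M using that I_open by (intro flat_wall_first)
  show ?thesis
  proof (intro conjI ballI)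
    fix t m
    assume t: "t \<in> {0..T}"
      and m: "m \<in> closure (free_surface M (\<eta> t)) \<inter> closure (fixed_boundary M b (\<eta> t))"
    show "\<forall>n \<nu>. unit_normal (closure (fixed_boundary M b (\<eta> t))) m n \<and>
      unit_normal (closure (free_surface M (\<eta> t))) m \<nu> \<longrightarrow> n \<bullet> \<nu> = 0"
    proof (intro allI impI, elim conjE)
      fix n \<nu>
      assume n: "unit_normal (closure (fixed_boundary M b (\<eta> t))) m n"
        and \<nu>: "unit_normal (closure (free_surface M (\<eta> t))) m \<nu>"
      obtain x where x: "x \<in> frontier M" "m = (x, \<eta> t x)"
        using contact_point[OF t m] .
      obtain x1 x2 where x12: "x = (x1, x2)" by fastforce
      have n': "norm n = 1" "orthogonal_to_surface (closure (fixed_boundary M b (\<eta> t))) (x, \<eta> t x) n"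
        and \<nu>': "orthogonal_to_surface (closure (free_surface M (\<eta> t))) (x, \<eta> t x) \<nu>"
        using n \<nu> x by (simp_all add: unit_normal_def)
      have fr: "x1 \<in> {0..1}" "x2 \<in> closure I" "x1 \<in> {0<..<1} \<Longrightarrow> x2 \<notin> I"
        using x(1) by (auto simp: x12 M frontier_rectangle[OF I_open])
      show "n \<bullet> \<nu> = 0"
      proof (cases "x2 \<in> I")
        case True
        then have "x1 \<in> {0, 1}" using fr by force
        with True obtain \<sigma> where "flat_wall M x (\<sigma>, 0)" using wall x12 by blast
        then show ?thesis using n' \<nu>' by (intro right_angle[OF t])
      next
        case False
        \<comment> \<open>\<open>x2 \<notin> I\<close> excludes the canal, where \<open>I\<close> is
          the whole line.\<close>
        then obtain L where L: "0 < L" "I = {0<..<L}" using I by auto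
        have x2: "x2 \<in> {0, L}" using fr(2) False L by auto
        show ?thesis
        proof (cases "x1 \<in> {0<..<1}")
          case True
          then obtain \<sigma> where "flat_wall M x (0, \<sigma>)"
            using flat_wall_second[OF True x2 L(1)] by (auto simp: x12 M L)
          then show ?thesis using n' \<nu>' by (intro right_angle[OF t])
        next
          case False
          then have "x1 \<in> {0, 1}" using fr(1) by auto
          then have "n = 0"
            using M L t x2 n'(2) unfolding x12 by (intro no_normal_at_corner) auto
          then show ?thesis using n'(1) by simp
        qed
      qed
    qed
  next
    fix t x1 x2
    assume t: "t \<in> {0..T}" and x: "x1 \<in> {0, 1::real}" "x2 \<in> I"
    obtain \<sigma> where \<sigma>: "\<bar>\<sigma>\<bar> = 1" "flat_wall M (x1, x2) (\<sigma>, 0)" using wall[OF x] by blast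
    \<comment> \<open>\<open>contact_slope\<close> speaks of the inward normal; linearity and
      \<open>\<sigma> \<noteq> 0\<close> turn it into the derivative in \<open>x1\<close>.\<close>
    have "((0, \<sigma>, 0) :: real \<times> R2) = \<sigma> *\<^sub>R (0, 1, 0)" by simp
    then have slope: "\<eta>' (t, x1, x2) (0, 1, 0) = 0"
      using contact_slope[OF t \<sigma>(2)] \<sigma>(1) by (metis abs_zero blinfun.scaleR_right scaleR_eq_0_iff zero_neq_one)
    have cl: "(s, x2) \<in> closure M" if "s \<in> {0..1}" for s
      using that x(2) closure_subset[of I] by (auto simp: M closure_Times)
    have "((\<lambda>s. (\<lambda>(t, x). \<eta> t x) (t, s, x2)) has_vector_derivative \<eta>' (t, x1, x2) (0, 1, 0)) (at x1 within {0..1})"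
    proof (rule has_vector_derivative_compose_eventually[where \<gamma>="\<lambda>s. (t, s, x2)", OF \<eta>'])
      show "((\<lambda>s. (t, s, x2)) has_vector_derivative (0, 1, 0)) (at x1 within {0..1})"
        by (intro has_vector_derivative_Pair has_vector_derivative_const has_vector_derivative_id)
      show "\<forall>\<^sub>F s in at x1 within {0..1}. (t, s, x2) \<in> {0..T} \<times> closure M"
        using t cl by (simp add: eventually_at_filter)
    qed (use t x cl in auto)
    then have "((\<lambda>s. \<eta> t (s, x2)) has_real_derivative 0) (at x1 within {0..1})"
      by (simp add: slope has_real_derivative_iff_has_vector_derivative)
    \<comment> \<open>Both sides of the equivalence hold outright: the right one was just derived,
      the left one is \<open>right_angle\<close>.\<close>
    then show "(\<forall>n \<nu>. unit_normal (closure (fixed_boundary M b (\<eta> t))) ((x1, x2), \<eta> t (x1, x2)) n \<and>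
                   unit_normal (closure (free_surface M (\<eta> t))) ((x1, x2), \<eta> t (x1, x2)) \<nu> \<longrightarrow>
                   n \<bullet> \<nu> = 0) \<longleftrightarrow>
            ((\<lambda>s. \<eta> t (s, x2)) has_real_derivative 0) (at x1 within {0..1})"
      using right_angle[OF t \<sigma>(2)] unfolding unit_normal_def by blast
  qed
qed

end
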